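(* Let $p$ be a prime and let $G=T_{2(lp^t)}=T_{4n}\le S_{4n}$, where $2n=lp^t$ and $p\nmid l$. Let $C=\langle r^{p^t}\rangle$, let $\gamma\in\Delta$, and write $C\cap G_\gamma=\langle r^{t_\gamma p^t}\rangle$ where $t_\gamma=\frac{l}{|C\cap G_\gamma|}$. Let $1\le b<\frac l2$ and $\phi=\hat\psi_b$ (if $n$ is even) or $\phi=\hat\psi'_b$ (if $n$ is odd). Then for each $\sigma\in C$, $e^\phi_{\gamma\sigma}=0$ if and only if $\frac{bt_\gamma}{l}\notin\mathbb{Z}$.
   Context: The dicyclic group is $T_{4n}=\langle r,s\mid r^{2n}=e,\ r^n=s^2,\ s^{-1}rs=r^{-1}\rangle=\{r^i,sr^i:0\le i<2n\}$. It is embedded in $S_{4n}$ (Cayley) by $r=(1\,2\cdots 2n)(2n+1\ \ 2n+2\cdots 4n)$ and $s=(1\ \ 2n+1\ \ n+1\ \ 3n+1)\prod_{i=2}^{n}(i\ \ 4n+2-i\ \ n+i\ \ 3n+2-i)$. For $1\le j\le n-1$ the two-dimensional irreducible character $\psi_j$ ($n$ even), resp. $\psi'_j$ ($n$ odd), of $T_{4n}$ takes the value $2\cos(kj\pi/n)$ at $r^k$ and $0$ at every $sr^k$. $\hat G$ is the set of $p$-regular elements of $G$ (order not divisible by $p$), and $\hat\psi_b=\psi_b|_{\hat G}$, $\hat\psi'_b=\psi'_b|_{\hat G}$. $V$ is a $k$-dimensional complex inner product space with orthonormal basis $e_1,\dots,e_k$; with $m=4n$, $\Gamma^m_k$ is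 the set of sequences $\alpha=(\alpha_1,\dots,\alpha_m)$ with $1\le\alpha_i\le k$; $\alpha\sigma=(\alpha_{\sigma(1)},\dots,\alpha_{\sigma(m)})$ for $\sigma\in G$; $G_\alpha$ is the stabilizer of $\alpha$; $\Delta$ is a set of representatives of the $G$-orbits on $\Gamma^m_k$; $e_\alpha=e_{\alpha_1}\otimes\cdots\otimes e_{\alpha_m}$; and, with $S=\hat G$, $$e^\phi_\alpha=\frac{\phi(e)}{|S|}\sum_{\sigma\in S}\phi(\sigma)e_{\alpha\sigma^{-1}}.$$ *)

theory Defs
  imports
    Complex_Main
    "HOL-Algebra.Algebra"
    "HOL-Library.Function_Algebras"
begin

subsection \<open>The dicyclic group inside the symmetric group\<close>

definition dicyclic_r :: "nat \<Rightarrow> nat \<Rightarrow> nat" where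
  "dicyclic_r n = cycle_of_list [1..<2*n + 1] \<circ> cycle_of_list [2*n + 1..<4*n + 1]"

definition dicyclic_s :: "nat \<Rightarrow> nat \<Rightarrow> nat" where
  "dicyclic_s n = cycle_of_list [1, 2*n + 1, n + 1, 3*n + 1] \<circ>
     foldr (\<circ>) (map (\<lambda>i. cycle_of_list [i, 4*n + 2 - i, n + i, 3*n + 2 - i]) [2..<n + 1]) id"

text \<open>Permutations compose from right to left, so that \<open>\<alpha> \<circ> \<sigma>\<close> below is the right action
  \<open>\<alpha>\<sigma> = (\<alpha>\<^sub>\<sigma>\<^sub>(\<^sub>1\<^sub>), \<dots>, \<alpha>\<^sub>\<sigma>\<^sub>(\<^sub>m\<^sub>))\<close>.\<close>

definition dicyclic :: "nat \<Rightarrow> (nat \<Rightarrow> nat) monoid" where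
  "dicyclic n = subgroup_generated (sym_group (4*n)) {dicyclic_r n, dicyclic_s n}"

definition p_regular_elements :: "nat \<Rightarrow> ('a, 'b) monoid_scheme \<Rightarrow> 'a set" where
  "p_regular_elements p G = {g \<in> carrier G. \<not> p dvd group.ord G g}"

text \<open>The two-dimensional irreducible characters \<open>\<psi>\<^sub>j\<close> (\<open>n\<close> even) and \<open>\<psi>'\<^sub>j\<close> (\<open>n\<close> odd), for
  \<open>1 \<le> j \<le> n - 1\<close>, are given by the same formula in both parities: \<open>2 cos (k j \<pi> / n)\<close> at
  \<open>r\<^sup>k\<close>, and \<open>0\<close> at every \<open>s r\<^sup>k\<close>. The formula has period \<open>2 n\<close> in \<open>k\<close>, so any exponent \<open>k\<close>
  of a given rotation may be chosen.\<close>

definition dicyclic_char :: "nat \<Rightarrow> nat \<Rightarrow> (nat \<Rightarrow> nat) \<Rightarrow> complex" where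
  "dicyclic_char n j g =
     (if \<exists>k::nat. g = dicyclic_r n [^]\<^bsub>dicyclic n\<^esub> k
      then let k = (LEAST k::nat. g = dicyclic_r n [^]\<^bsub>dicyclic n\<^esub> k)
           in complex_of_real (2 * cos (real k * real j * pi / real n))
      else 0)"


subsection \<open>Sequences and the permutation action on them\<close>

definition index_seqs :: "nat \<Rightarrow> nat \<Rightarrow> (nat \<Rightarrow> nat) set" where
  "index_seqs m k = {1..m} \<rightarrow>\<^sub>E {1..k}"

definition seq_stabilizer :: "(nat \<Rightarrow> nat) monoid \<Rightarrow> (nat \<Rightarrow> nat) \<Rightarrow> (nat \<Rightarrow> nat) set" where
  "seq_stabilizer G \<alpha> = {\<sigma> \<in> carrier G. \<alpha> \<circ> \<sigma> = \<alpha>}"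

definition seq_orbit :: "(nat \<Rightarrow> nat) monoid \<Rightarrow> (nat \<Rightarrow> nat) \<Rightarrow> (nat \<Rightarrow> nat) set" where
  "seq_orbit G \<alpha> = {\<alpha> \<circ> \<sigma> | \<sigma>. \<sigma> \<in> carrier G}"

definition orbit_representatives ::
  "(nat \<Rightarrow> nat) monoid \<Rightarrow> nat \<Rightarrow> nat \<Rightarrow> (nat \<Rightarrow> nat) set \<Rightarrow> bool" where
  "orbit_representatives G m k \<Delta> \<longleftrightarrow>
     \<Delta> \<subseteq> index_seqs m k \<and> (\<forall>\<alpha> \<in> index_seqs m k. \<exists>!\<delta>. \<delta> \<in> \<Delta> \<and> \<delta> \<in> seq_orbit G \<alpha>)"


subsection \<open>Complex inner product spaces and tensor powers\<close>

text \<open>The space is the whole type \<open>'v\<close>, with scalar multiplication \<open>scale\<close>; the inner product is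
  linear in its first argument.\<close>

locale complex_inner_product_space = vector_space scale
  for scale :: "complex \<Rightarrow> 'v::ab_group_add \<Rightarrow> 'v" +
  fixes ip :: "'v \<Rightarrow> 'v \<Rightarrow> complex"
  assumes ip_add_left: "ip (x + y) z = ip x z + ip y z"
    and ip_scale_left: "ip (scale c x) y = c * ip x y"
    and ip_cnj: "ip y x = cnj (ip x y)"
    and ip_pos: "x \<noteq> 0 \<Longrightarrow> Re (ip x x) > 0"

locale complex_inner_product_space_onb = complex_inner_product_space scale ip
  for scale :: "complex \<Rightarrow> 'v::ab_group_add \<Rightarrow> 'v" and ip :: "'v \<Rightarrow> 'v \<Rightarrow> complex" +
  fixes k :: nat and e :: "nat \<Rightarrow> 'v"
  assumes onb_orthonormal:
      "i \<in> {1..k} \<Longrightarrow> j \<in> {1..k} \<Longrightarrow> ip (e i) (e j) = (if i = j then 1 else 0)"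
    and onb_span: "span (e ` {1..k}) = UNIV"

text \<open>The \<open>m\<close>-th tensor power of the finite-dimensional space \<open>'v\<close> is realised as the dual of the
  space of \<open>m\<close>-linear forms on \<open>'v\<close>, with \<open>v\<^sub>1 \<otimes> \<dots> \<otimes> v\<^sub>m\<close> the evaluation
  \<open>f \<mapsto> f (v\<^sub>1, \<dots>, v\<^sub>m)\<close>. An \<open>m\<close>-tuple of vectors is a function on \<open>nat\<close> of which only the
  values on \<open>{1..m}\<close> matter; tensors vanish, by convention, on arguments that are not
  \<open>m\<close>-linear forms, so that equality of tensors is equality of functions, with the pointwise
  \<open>0\<close> and \<open>+\<close>.\<close>

definition multilinear_form ::
  "(complex \<Rightarrow> 'v \<Rightarrow> 'v) \<Rightarrow> nat \<Rightarrow> ((nat \<Rightarrow> 'v::ab_group_add) \<Rightarrow> complex) \<Rightarrow> bool" where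
  "multilinear_form scale m f \<longleftrightarrow>
     (\<forall>v w. (\<forall>i\<in>{1..m}. v i = w i) \<longrightarrow> f v = f w) \<and>
     (\<forall>v. \<forall>i\<in>{1..m}. \<forall>x y. f (v(i := x + y)) = f (v(i := x)) + f (v(i := y))) \<and>
     (\<forall>v. \<forall>i\<in>{1..m}. \<forall>c x. f (v(i := scale c x)) = c * f (v(i := x)))"

type_synonym 'v tensor = "((nat \<Rightarrow> 'v) \<Rightarrow> complex) \<Rightarrow> complex"

definition tensor_prod ::
  "(complex \<Rightarrow> 'v \<Rightarrow> 'v) \<Rightarrow> nat \<Rightarrow> (nat \<Rightarrow> 'v::ab_group_add) \<Rightarrow> 'v tensor" where
  "tensor_prod scale m v = (\<lambda>f. if multilinear_form scale m f then f v else 0)"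

definition tensor_scale :: "complex \<Rightarrow> 'v tensor \<Rightarrow> 'v tensor" where
  "tensor_scale c x = (\<lambda>f. c * x f)"

definition basis_tensor ::
  "(complex \<Rightarrow> 'v \<Rightarrow> 'v) \<Rightarrow> nat \<Rightarrow> (nat \<Rightarrow> 'v::ab_group_add) \<Rightarrow> (nat \<Rightarrow> nat) \<Rightarrow> 'v tensor" where
  "basis_tensor scale m e \<alpha> = tensor_prod scale m (\<lambda>i. e (\<alpha> i))"

definition symmetrized_tensor ::
  "(complex \<Rightarrow> 'v \<Rightarrow> 'v) \<Rightarrow> nat \<Rightarrow> (nat \<Rightarrow> 'v::ab_group_add) \<Rightarrow> (nat \<Rightarrow> nat) monoid \<Rightarrow>
     (nat \<Rightarrow> nat) set \<Rightarrow> ((nat \<Rightarrow> nat) \<Rightarrow> complex) \<Rightarrow> (nat \<Rightarrow> nat) \<Rightarrow> 'v tensor" where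
  "symmetrized_tensor scale m e G S \<phi> \<alpha> =
     tensor_scale (\<phi> \<one>\<^bsub>G\<^esub> / of_nat (card S))
       (\<Sum>\<sigma>\<in>S. tensor_scale (\<phi> \<sigma>) (basis_tensor scale m e (\<alpha> \<circ> inv\<^bsub>G\<^esub> \<sigma>)))"

end

theory Submission
  imports Defs
begin

text \<open>
  Among the rotations \<open>r\<^sup>k\<close> the \<open>p\<close>-regular ones are exactly the powers of \<open>c = r^(p^t)\<close>, an
  element of order \<open>l\<close>, and the character vanishes on every element that is not a rotation.
  So \<open>e\<^sup>\<phi>\<^sub>\<alpha>\<close> is, up to a nonzero factor, the sum of \<open>\<phi>(\<tau>) e_(\<alpha>\<tau>\<^sup>-\<^sup>1)\<close> over the cyclic group
  \<open>C = \<langle>c\<rangle>\<close> of order \<open>l\<close>, and there \<open>\<phi>(c\<^sup>m) = w\<^sup>m + w\<^sup>-\<^sup>m\<close> with \<open>w = exp (2 \<pi> i b / l)\<close>.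

  A subgroup of a finite cyclic group is determined by its cardinality, so the stabilizer of
  \<open>\<gamma>\<close> in \<open>C\<close> is generated by \<open>c\<^sup>s\<close> with \<open>s = t\<^sub>\<gamma>\<close>. Since \<open>C\<close> is commutative, for \<open>\<sigma> \<in> C\<close> the
  tensor \<open>F m\<close> of the sequence \<open>\<gamma>\<sigma>c\<^sup>-\<^sup>m\<close> depends on \<open>m\<close> only modulo \<open>s\<close>.

  If \<open>w\<^sup>s \<noteq> 1\<close>, replacing \<open>m\<close> by \<open>m + s\<close> multiplies the sum of \<open>w\<^sup>m F m\<close> over \<open>m < l\<close> by
  \<open>w\<^sup>s\<close>; as the summand has period \<open>l\<close>, the value does not change either, so the sum vanishes. The
  same holds with \<open>w\<^sup>-\<^sup>1\<close> in place of \<open>w\<close>; this is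
  \<open>twisted_periodic_sum_eq_0\<close>. If \<open>w\<^sup>s = 1\<close>, the character is \<open>2\<close> on the whole stabilizer, so the
  coefficient of \<open>e_(\<gamma>\<sigma>)\<close> is twice the order of the stabilizer; this is \<open>sum_char_stabilizer\<close>.
  The coefficient can be read off because \<open>basis_tensor_coordinate\<close> provides a form that is \<open>1\<close> on
  one basis tensor and \<open>0\<close> on the others. Finally \<open>w\<^sup>s = 1\<close> means that \<open>b s / l\<close> is an integer.
\<close>

section \<open>Finite cyclic groups\<close>

lemma (in group) pow_eq_pow_iff_cong:
  assumes "x \<in> carrier G"
  shows "x [^] (i::nat) = x [^] (j::nat) \<longleftrightarrow> int (ord x) dvd int j - int i"
  using int_pow_eq[OF assms, of "int i" "int j"] by (simp add: int_pow_int)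

lemma (in group) sum_generate_singleton:
  assumes "c \<in> carrier G" and "ord c \<noteq> 0"
  shows "sum g (generate G {c}) = (\<Sum>m\<in>{..<ord c}. g (c [^] m))"
proof -
  have eq: "{0..ord c - 1} = {..<ord c}"
    using assms(2) by auto
  have "generate G {c} = (\<lambda>m. c [^] m) ` {..<ord c}"
    using generate_pow_nat[OF assms] ord_elems_inf_carrier[OF assms] unfolding eq by (auto simp: image_def)
  then show ?thesis
    using ord_inj[OF assms(1)] unfolding eq by (simp add: sum.reindex)
qed

text \<open>From \<open>ord x = gcd (ord x) j * ord (x\<^sup>j)\<close>: the factor \<open>p\<^sup>t\<close> of \<open>ord x\<close> is split between the two
  factors on the right, and \<open>p\<close> is missing from the second one exactly when the whole of \<open>p\<^sup>t\<close>
  lies in the greatest common divisor.\<close>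

lemma (in group) not_dvd_ord_pow_iff:
  assumes x: "x \<in> carrier G" and p: "Factorial_Ring.prime p"
    and ord: "ord x = l * p ^ t" and l: "\<not> p dvd l"
  shows "\<not> p dvd ord (x [^] (j::nat)) \<longleftrightarrow> p ^ t dvd j"
proof -
  have N0: "ord x \<noteq> 0" using p l ord by (cases l) (auto simp: prime_gt_0_nat)
  have g: "ord x = gcd (ord x) j * ord (x [^] j)"
    using ord_pow_gen[OF x, of j] N0 by auto
  show ?thesis
  proof
    assume "\<not> p dvd ord (x [^] j)"
    then have "coprime (p ^ t) (ord (x [^] j))"
      using p by (simp add: prime_imp_coprime_nat)
    moreover have "p ^ t dvd gcd (ord x) j * ord (x [^] j)"
      using g ord by (metis dvd_triv_right)
    ultimately have "p ^ t dvd gcd (ord x) j"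
      by (simp add: coprime_dvd_mult_left_iff)
    then show "p ^ t dvd j"
      using gcd_dvd2 by (rule dvd_trans)
  next
    assume "p ^ t dvd j"
    then obtain q where "gcd (ord x) j = p ^ t * q"
      using ord by (metis dvd_def dvd_triv_right gcd_greatest)
    then have "l = q * ord (x [^] j)"
      using g ord p by (simp add: prime_gt_0_nat)
    then show "\<not> p dvd ord (x [^] j)"
      using l by (metis dvd_mult)
  qed
qed

text \<open>By Lagrange, with \<open>d = card H\<close>, every \<open>c\<^sup>m\<close> in \<open>H\<close> satisfies \<open>ord c dvd m d\<close>, that is, \<open>m\<close> is a
  multiple of \<open>ord c div d\<close>. This puts \<open>H\<close> inside a cyclic group that has exactly \<open>d\<close> elements.\<close>

lemma (in group) subgroup_of_finite_cyclic:
  assumes c: "c \<in> carrier G" and fin: "ord c \<noteq> 0"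
    and H: "subgroup H G" "H \<subseteq> generate G {c}"
  shows "card H dvd ord c" and "H = generate G {c [^] (ord c div card H)}"
proof -
  let ?C = "generate G {c}"
  let ?d = "card H"
  have C: "subgroup ?C G"
    using c by (intro generate_is_subgroup) auto
  interpret C: group "G\<lparr>carrier := ?C\<rparr>"
    using C by (rule subgroup_imp_group)
  have HC: "subgroup H (G\<lparr>carrier := ?C\<rparr>)"
    using subgroup_incl[OF H(1) C H(2)] .
  have cardC: "card ?C = ord c"
    by (simp add: generate_pow_card[OF c])
  show dvd: "?d dvd ord c"
    using C.lagrange[OF HC] cardC by (metis order_def dvd_triv_right partial_object.select_convs(1) partial_object.surjective partial_object.update_convs(1))
  then have d0: "?d \<noteq> 0" using fin by auto
  have finC: "finite ?C" using cardC fin by (metis card.infinite)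
  interpret H: group "G\<lparr>carrier := H\<rparr>"
    using H(1) by (rule subgroup_imp_group)
  have "H \<subseteq> generate G {c [^] (ord c div ?d)}"
  proof
    fix x assume x: "x \<in> H"
    obtain m :: nat where m: "x = c [^] m"
      using x H(2) generate_pow_nat[OF c fin] by blast
    have "x [^]\<^bsub>G\<lparr>carrier := H\<rparr>\<^esub> order (G\<lparr>carrier := H\<rparr>) = \<one>"
      using H.pow_order_eq_1[of x] x by simp
    then have "x [^] ?d = \<one>"
      by (simp add: order_def nat_pow_consistent[symmetric])
    then have "ord c dvd m * ?d"
      using m c by (simp add: nat_pow_pow pow_eq_id)
    then have "ord c div ?d dvd m"
      using dvd d0 by (metis div_dvd_iff_mult)
    then obtain q where "m = (ord c div ?d) * q" ..
    then have "x = (c [^] (ord c div ?d)) [^] int q"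
      using m c by (simp add: nat_pow_pow int_pow_int)
    then show "x \<in> generate G {c [^] (ord c div ?d)}"
      using generate_pow[of "c [^] (ord c div ?d)"] c by blast
  qed
  moreover have "card (generate G {c [^] (ord c div ?d)}) = ?d"
  proof -
    have "ord c div ?d dvd ord c" "ord c div ?d \<noteq> 0"
      using dvd fin by (auto elim!: dvdE)
    then have "ord (c [^] (ord c div ?d)) = ord c div (ord c div ?d)"
      using c by (intro ord_pow)
    also have "\<dots> = ?d" using dvd fin d0 by (auto elim!: dvdE)
    finally show ?thesis
      using generate_pow_card[of "c [^] (ord c div ?d)"] c by simp
  qed
  moreover from this have "finite (generate G {c [^] (ord c div ?d)})"
    using d0 by (metis card.infinite)
  ultimately show "H = generate G {c [^] (ord c div ?d)}"
    by (metis card_subset_eq)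
qed

section \<open>Rotations in the dicyclic group\<close>

lemma rotation_of_interval:
  assumes "i < m"
  shows "(cycle_of_list [a..<a + m] ^^ k) (a + i) = a + (i + k) mod m"
proof -
  have "(cycle_of_list [a..<a + m] ^^ k) ([a..<a + m] ! i) = rotate k [a..<a + m] ! i"
    using cyclic_rotation[of "[a..<a + m]" k] assms by (metis add_diff_cancel_left' distinct_upt length_upt nth_map)
  with assms show ?thesis
    by (simp add: nth_rotate add.commute)
qed

lemma dicyclic_r_permutes: "dicyclic_r n permutes {1..4 * n}"
proof -
  have "cycle_of_list [1..<2*n + 1] permutes {1..4*n}" "cycle_of_list [2*n + 1..<4*n + 1] permutes {1..4*n}"
    by (rule permutes_subset[OF cycle_permutes], auto)+
  then show ?thesis
    unfolding dicyclic_r_def by (blast intro: permutes_compose)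
qed

text \<open>The two cycles of \<open>r\<close> have disjoint supports and hence commute.\<close>

lemma dicyclic_r_funpow:
  "dicyclic_r n ^^ k = (cycle_of_list [1..<2*n + 1] ^^ k) \<circ> (cycle_of_list [2*n + 1..<4*n + 1] ^^ k)"
proof (induction k)
  case 0
  show ?case by simp
next
  case (Suc k)
  let ?A = "cycle_of_list [1..<2*n + 1]" and ?B = "cycle_of_list [2*n + 1..<4*n + 1]"
  have comm: "?A \<circ> ?B = ?B \<circ> ?A"
    by (rule cycles_commute) auto
  have "(?A ^^ j) \<circ> ?B = ?B \<circ> (?A ^^ j)" for j
  proof (induction j)
    case (Suc j)
    have "(?A ^^ Suc j) \<circ> ?B = ?A \<circ> ((?A ^^ j) \<circ> ?B)" by (simp add: comp_assoc)
    also have "\<dots> = (?A \<circ> ?B) \<circ> (?A ^^ j)" by (simp only: Suc comp_assoc)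
    also have "\<dots> = ?B \<circ> (?A ^^ Suc j)" by (simp only: comm comp_assoc funpow.simps)
    finally show ?case .
  qed simp
  note comm' = this
  have "dicyclic_r n ^^ Suc k = (?A \<circ> ?B) \<circ> ((?A ^^ k) \<circ> (?B ^^ k))"
    by (simp only: funpow.simps Suc) (simp only: dicyclic_r_def)
  also have "\<dots> = ?A \<circ> (?B \<circ> (?A ^^ k)) \<circ> (?B ^^ k)" by (simp only: comp_assoc)
  also have "\<dots> = (?A ^^ Suc k) \<circ> (?B ^^ Suc k)"
    by (simp only: comm'[symmetric] comp_assoc funpow.simps)
  finally show ?case .
qed

text \<open>A power of \<open>r\<close> moves \<open>1\<close> to \<open>1 + k mod 2n\<close>, because only the first cycle touches \<open>1\<close>.\<close>

lemma dicyclic_r_funpow_eq_id_iff: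
  assumes "n > 0"
  shows "dicyclic_r n ^^ k = id \<longleftrightarrow> 2 * n dvd k"
proof
  let ?A = "cycle_of_list [1..<2*n + 1]" and ?B = "cycle_of_list [2*n + 1..<4*n + 1]"
  assume "dicyclic_r n ^^ k = id"
  moreover have "(?B ^^ j) 1 = 1" for j
    using id_outside_supp[of 1 "[2*n + 1..<4*n + 1]"] assms by (induction j) auto
  moreover have "(?A ^^ k) 1 = 1 + k mod (2*n)"
    using rotation_of_interval[of 0 "2*n" k 1] assms by (simp add: add.commute)
  ultimately have "k mod (2*n) = 0"
    by (metis comp_apply dicyclic_r_funpow id_apply add_eq_self_zero)
  then show "2 * n dvd k" by auto
next
  let ?A = "cycle_of_list [1..<2*n + 1]" and ?B = "cycle_of_list [2*n + 1..<4*n + 1]"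
  assume "2 * n dvd k"
  then obtain j where j: "k = 2 * n * j" ..
  have "?A ^^ (2 * n) = id" "?B ^^ (2 * n) = id"
    using cycle_is_id_root[of "[1..<2*n + 1]"] cycle_is_id_root[of "[2*n + 1..<4*n + 1]"]
    by (simp_all del: upt_Suc)
  then have "dicyclic_r n ^^ (2 * n) = id"
    unfolding dicyclic_r_funpow by simp
  then show "dicyclic_r n ^^ k = id"
    unfolding j funpow_mult[symmetric] by simp
qed

lemma group_dicyclic: "group (dicyclic n)"
  unfolding dicyclic_def by (rule group.group_subgroup_generated[OF sym_group_is_group])

lemma dicyclic_mult: "x \<otimes>\<^bsub>dicyclic n\<^esub> y = x \<circ> y"
  by (simp add: dicyclic_def sym_group_mult)

lemma dicyclic_one: "\<one>\<^bsub>dicyclic n\<^esub> = id"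
  by (simp add: dicyclic_def sym_group_one)

lemma carrier_dicyclic_permutes: "x \<in> carrier (dicyclic n) \<Longrightarrow> x permutes {1..4 * n}"
  using group.subgroup_subgroup_generated[OF sym_group_is_group] subgroup.mem_carrier
  unfolding dicyclic_def by (metis sym_group_carrier)

lemma finite_carrier_dicyclic: "finite (carrier (dicyclic n))"
  using finite_permutations[of "{1..4 * n}"] carrier_dicyclic_permutes
  by (metis (mono_tags, lifting) finite_atLeastAtMost finite_subset mem_Collect_eq subsetI)

lemma dicyclic_r_in_carrier: "dicyclic_r n \<in> carrier (dicyclic n)"
  using dicyclic_r_permutes
  by (auto simp: dicyclic_def carrier_subgroup_generated sym_group_carrier intro: generate.incl)

lemma dicyclic_pow: "x [^]\<^bsub>dicyclic n\<^esub> (k::nat) = x ^^ k"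
proof (induction k)
  case 0
  then show ?case by (simp add: dicyclic_one)
next
  case (Suc k)
  then show ?case
    by (metis dicyclic_mult funpow_Suc_right nat_pow_Suc)
qed

lemma ord_dicyclic_r:
  assumes "n > 0"
  shows "group.ord (dicyclic n) (dicyclic_r n) = 2 * n"
  using dicyclic_r_funpow_eq_id_iff[OF assms]
  by (simp add: group.ord_unique[OF group_dicyclic dicyclic_r_in_carrier] dicyclic_pow dicyclic_one)

text \<open>The least exponent chosen in the definition of the character is congruent to \<open>k\<close> modulo
  the order \<open>2n\<close> of \<open>r\<close>, which changes the argument of the cosine by a multiple of \<open>2\<pi>\<close>.\<close>

lemma dicyclic_char_rotation:
  assumes "n > 0"
  shows "dicyclic_char n j (dicyclic_r n [^]\<^bsub>dicyclic n\<^esub> (k::nat)) =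
    complex_of_real (2 * cos (real k * real j * pi / real n))"
proof -
  let ?r = "\<lambda>i::nat. dicyclic_r n [^]\<^bsub>dicyclic n\<^esub> i"
  define k' where "k' = (LEAST i. ?r k = ?r i)"
  have "?r k = ?r k'"
    unfolding k'_def by (rule LeastI) (rule refl)
  then have "int (2 * n) dvd int k' - int k"
    by (simp only: group.pow_eq_pow_iff_cong[OF group_dicyclic dicyclic_r_in_carrier] ord_dicyclic_r[OF assms])
  then obtain q where q: "int k' - int k = int (2 * n) * q" ..
  have k: "real k = real k' + 2 * real n * of_int (- q)"
    using arg_cong[OF q, of real_of_int] by simp
  have "real k * real j * pi / real n = real k' * real j * pi / real n + 2 * pi * of_int (- q * int j)"
    unfolding k using assms by (simp add: field_simps)
  then have "cos (real k * real j * pi / real n) = cos (real k' * real j * pi / real n)"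
    by (metis cos_add cos_int_2pin mult.right_neutral mult_zero_right sin_int_2pin diff_zero)
  then show ?thesis
    unfolding dicyclic_char_def k'_def[symmetric] Let_def by auto
qed

lemma subgroup_seq_stabilizer: "subgroup (seq_stabilizer (dicyclic n) \<alpha>) (dicyclic n)"
proof -
  interpret group "dicyclic n" by (rule group_dicyclic)
  show ?thesis
  proof
    fix x assume x: "x \<in> seq_stabilizer (dicyclic n) \<alpha>"
    then have "x \<in> carrier (dicyclic n)" "\<alpha> \<circ> x = \<alpha>"
      by (auto simp: seq_stabilizer_def)
    then have "\<alpha> \<circ> inv\<^bsub>dicyclic n\<^esub> x = \<alpha> \<circ> (x \<otimes>\<^bsub>dicyclic n\<^esub> inv\<^bsub>dicyclic n\<^esub> x)"
      by (simp only: dicyclic_mult) (metis comp_assoc)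
    also have "\<dots> = \<alpha>"
      using \<open>x \<in> carrier (dicyclic n)\<close> by (simp only: r_inv) (simp add: dicyclic_one)
    finally show "inv\<^bsub>dicyclic n\<^esub> x \<in> seq_stabilizer (dicyclic n) \<alpha>"
      using x by (simp add: seq_stabilizer_def)
  next
    fix x y
    assume "x \<in> seq_stabilizer (dicyclic n) \<alpha>" "y \<in> seq_stabilizer (dicyclic n) \<alpha>"
    then show "x \<otimes>\<^bsub>dicyclic n\<^esub> y \<in> seq_stabilizer (dicyclic n) \<alpha>"
      by (simp add: seq_stabilizer_def) (metis comp_assoc dicyclic_mult)
  qed (use one_closed in \<open>auto simp: seq_stabilizer_def dicyclic_one\<close>)
qed

section \<open>Twisted sums over a period\<close>

lemma sum_periodic_shift:
  fixes g :: "nat \<Rightarrow> 'a::comm_monoid_add"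
  assumes "\<And>m. g (m + l) = g m"
  shows "(\<Sum>m<l. g (m + t)) = (\<Sum>m<l. g m)"
proof (induction t)
  case (Suc t)
  have "(\<Sum>m<l. g (m + Suc t)) = (\<Sum>m<l. g (m + t))"
  proof (cases l)
    case (Suc l')
    have "(\<Sum>m<Suc l'. g (m + Suc t)) = (\<Sum>m<l'. g (Suc m + t)) + g (t + l)"
      using Suc by (simp add: ac_simps)
    also have "\<dots> = (\<Sum>m<Suc l'. g (m + t))"
      unfolding assms sum.lessThan_Suc_shift by (simp add: ac_simps)
    finally show ?thesis using Suc by simp
  qed simp
  with Suc show ?case by simp
qed simp

text \<open>The orthogonality argument: the summation index can be shifted by \<open>t\<close>, which multiplies
  every term by \<open>w\<^sup>t\<close>.\<close>

lemma twisted_periodic_sum_eq_0: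
  fixes w :: "'a::idom"
  assumes "\<And>m. F (m + l) = F m" and "\<And>m. F (m + t) = F m" and "w ^ l = 1" and "w ^ t \<noteq> 1"
  shows "(\<Sum>m<l. w ^ m * F m) = 0"
proof -
  have "w ^ t * (\<Sum>m<l. w ^ m * F m) = (\<Sum>m<l. w ^ (m + t) * F (m + t))"
    by (simp add: sum_distrib_left assms(2) power_add mult_ac)
  also have "\<dots> = (\<Sum>m<l. w ^ m * F m)"
    by (rule sum_periodic_shift) (simp add: assms(1,3) power_add)
  finally show ?thesis using assms(4)
    by (metis mult_cancel_right1)
qed

lemma cis_eq_1_iff: "cis x = 1 \<longleftrightarrow> x / (2 * pi) \<in> \<int>"
proof -
  have "cis x = 1 \<longleftrightarrow> cos x = 1"
    using cos_one_sin_zero by (auto simp: complex_eq_iff)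
  also have "\<dots> \<longleftrightarrow> (\<exists>q::int. x / (2 * pi) = of_int q)"
    by (simp add: cos_one_2pi_int field_simps)
  also have "\<dots> \<longleftrightarrow> x / (2 * pi) \<in> \<int>"
    by (auto simp: Ints_def)
  finally show ?thesis .
qed

section \<open>Coordinates of basis tensors\<close>

lemma (in complex_inner_product_space) multilinear_form_prod_ip:
  fixes u :: "nat \<Rightarrow> 'v"
  shows "multilinear_form scale m (\<lambda>v. \<Prod>i\<in>{1..m}. ip (v i) (u i))"
proof -
  have split: "(\<Prod>j\<in>{1..m}. ip ((v(i := x)) j) (u j)) = ip x (u i) * (\<Prod>j\<in>{1..m} - {i}. ip (v j) (u j))"
    if "i \<in> {1..m}" for v i x
    using that by (subst prod.remove[of _ i]) (auto intro!: prod.cong)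
  show ?thesis
    unfolding multilinear_form_def
  proof (intro conjI allI ballI impI)
    fix v w :: "nat \<Rightarrow> 'v" assume "\<forall>i\<in>{1..m}. v i = w i"
    then show "(\<Prod>i\<in>{1..m}. ip (v i) (u i)) = (\<Prod>i\<in>{1..m}. ip (w i) (u i))"
      by (intro prod.cong) auto
  qed (simp_all only: split ip_add_left ip_scale_left distrib_right mult.assoc)
qed

text \<open>A multilinear form dual to \<open>e\<^sub>\<beta>\<close>: it separates the basis tensors and so reads off the coefficient
  of \<open>e\<^sub>\<beta>\<close> in any combination of them.\<close>

lemma (in complex_inner_product_space_onb) basis_tensor_coordinate:
  assumes "\<alpha> \<in> index_seqs m k" and "\<beta> \<in> index_seqs m k"
  shows "basis_tensor scale m e \<alpha> (\<lambda>v. \<Prod>i\<in>{1..m}. ip (v i) (e (\<beta> i))) = (if \<alpha> = \<beta> then 1 else 0)"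
proof -
  have "basis_tensor scale m e \<alpha> (\<lambda>v. \<Prod>i\<in>{1..m}. ip (v i) (e (\<beta> i)))
      = (\<Prod>i\<in>{1..m}. ip (e (\<alpha> i)) (e (\<beta> i)))"
    by (simp only: basis_tensor_def tensor_prod_def multilinear_form_prod_ip if_True)
  also have "\<dots> = (\<Prod>i\<in>{1..m}. if \<alpha> i = \<beta> i then 1 else 0)"
    using assms by (intro prod.cong refl onb_orthonormal) (auto simp: index_seqs_def)
  also have "\<dots> = (if \<forall>i\<in>{1..m}. \<alpha> i = \<beta> i then 1 else 0)"
    by auto
  also have "(\<forall>i\<in>{1..m}. \<alpha> i = \<beta> i) \<longleftrightarrow> \<alpha> = \<beta>"
    using assms unfolding index_seqs_def by (metis PiE_ext)
  finally show ?thesis .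
qed

lemma index_seqs_permute:
  assumes "\<alpha> \<in> index_seqs m k" and "x permutes {1..m}"
  shows "\<alpha> \<circ> x \<in> index_seqs m k"
proof -
  have "x i \<in> {1..m} \<longleftrightarrow> i \<in> {1..m}" for i
    using permutes_in_image[OF assms(2)] .
  with assms(1) show ?thesis
    unfolding index_seqs_def PiE_def Pi_def extensional_def by (auto simp del: atLeastAtMost_iff)
qed


section \<open>The cyclic group of \<open>p\<close>-regular rotations\<close>

text \<open>The subgroup \<open>C\<close> collects the part of \<open>\<langle>r\<rangle>\<close> of order prime to \<open>p\<close>.\<close>

locale dicyclic_p_part =
  fixes n p l t :: nat
  assumes prime_p: "Factorial_Ring.prime p"
    and double_n: "2 * n = l * p ^ t"
    and not_dvd_l: "\<not> p dvd l"
    and n_pos: "n > 0"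
begin

abbreviation "G \<equiv> dicyclic n"
abbreviation "r \<equiv> dicyclic_r n"
abbreviation "c \<equiv> r [^]\<^bsub>G\<^esub> (p ^ t)"
abbreviation "C \<equiv> generate G {c}"

sublocale group G
  by (rule group_dicyclic)

lemma c_in_carrier: "c \<in> carrier G"
  by (simp add: dicyclic_r_in_carrier)

lemma l_pos: "l > 0"
  using double_n n_pos by (cases l) auto

lemma ord_c: "ord c = l"
  using ord_pow[OF dicyclic_r_in_carrier[of n], of "p ^ t"] ord_dicyclic_r[OF n_pos] double_n prime_p
  by (simp add: prime_gt_0_nat)

lemma subgroup_C: "subgroup C G"
  using c_in_carrier by (intro generate_is_subgroup) auto

lemma C_subset: "C \<subseteq> carrier G"
  by (rule subgroup.subset[OF subgroup_C])

lemma C_eq: "C = {c [^]\<^bsub>G\<^esub> m | m. m \<in> (UNIV :: nat set)}"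
  using generate_pow_nat[OF c_in_carrier] ord_c l_pos by simp

lemma C_comm: "x \<in> C \<Longrightarrow> y \<in> C \<Longrightarrow> x \<otimes>\<^bsub>G\<^esub> y = y \<otimes>\<^bsub>G\<^esub> x"
  unfolding C_eq using c_in_carrier by (auto simp: nat_pow_mult add.commute)

lemma p_regular_rotation_iff: "r [^]\<^bsub>G\<^esub> (j::nat) \<in> p_regular_elements p G \<longleftrightarrow> r [^]\<^bsub>G\<^esub> j \<in> C"
proof -
  have *: "r [^]\<^bsub>G\<^esub> j \<in> p_regular_elements p G \<longleftrightarrow> p ^ t dvd j" for j :: nat
    using not_dvd_ord_pow_iff[OF dicyclic_r_in_carrier prime_p _ not_dvd_l] ord_dicyclic_r[OF n_pos] double_n
    by (simp add: p_regular_elements_def dicyclic_r_in_carrier)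
  show ?thesis
  proof
    assume "r [^]\<^bsub>G\<^esub> j \<in> p_regular_elements p G"
    then show "r [^]\<^bsub>G\<^esub> j \<in> C"
      unfolding * C_eq by (auto simp: dvd_def nat_pow_pow dicyclic_r_in_carrier)
  next
    assume "r [^]\<^bsub>G\<^esub> j \<in> C"
    then obtain m :: nat where "r [^]\<^bsub>G\<^esub> j = r [^]\<^bsub>G\<^esub> (p ^ t * m)"
      unfolding C_eq by (auto simp: nat_pow_pow dicyclic_r_in_carrier)
    then show "r [^]\<^bsub>G\<^esub> j \<in> p_regular_elements p G"
      by (simp add: *)
  qed
qed

text \<open>The \<open>p\<close>-regular elements outside \<open>C\<close> are not rotations, and the character vanishes there.\<close>

lemma sum_p_regular_char:
  "(\<Sum>\<tau>\<in>p_regular_elements p G. dicyclic_char n b \<tau> * F \<tau>) = (\<Sum>\<tau>\<in>C. dicyclic_char n b \<tau> * F \<tau>)"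
proof (rule sum.mono_neutral_right)
  show "finite (p_regular_elements p G)"
    using finite_carrier_dicyclic by (simp add: p_regular_elements_def)
  show "C \<subseteq> p_regular_elements p G"
  proof
    fix x assume "x \<in> C"
    moreover from this obtain j :: nat where "x = r [^]\<^bsub>G\<^esub> j"
      unfolding C_eq by (auto simp: nat_pow_pow dicyclic_r_in_carrier)
    ultimately show "x \<in> p_regular_elements p G"
      by (simp only: p_regular_rotation_iff)
  qed
  show "\<forall>\<tau>\<in>p_regular_elements p G - C. dicyclic_char n b \<tau> * F \<tau> = 0"
    using p_regular_rotation_iff by (auto simp: dicyclic_char_def)
qed

lemma dicyclic_char_C:
  fixes b m :: nat
  defines "w \<equiv> cis (2 * pi * real b / real l)"
  shows "dicyclic_char n b (c [^]\<^bsub>G\<^esub> m) = w ^ m + cnj w ^ m"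
proof -
  have n: "real n = real l * real (p ^ t) / 2"
    using arg_cong[OF double_n, of real] by simp
  have "real (p ^ t * m) * real b * pi / real n = real m * (2 * pi * real b / real l)"
    using prime_p unfolding n by (simp add: field_simps prime_gt_0_nat)
  then have "dicyclic_char n b (c [^]\<^bsub>G\<^esub> m) = complex_of_real (2 * cos (real m * (2 * pi * real b / real l)))"
    using dicyclic_char_rotation[OF n_pos, of b "p ^ t * m"] by (simp only: nat_pow_pow dicyclic_r_in_carrier)
  also have "\<dots> = w ^ m + cnj w ^ m"
    by (simp add: w_def cis_cnj Complex.DeMoivre complex_eq_iff)
  finally show ?thesis .
qed

text \<open>Moving \<open>y\<close> past \<open>x\<close> in the commutative group \<open>C\<close> shows that all translates of \<open>\<alpha>\<close> by \<open>C\<close> have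
  the same stabilizer in \<open>C\<close>.\<close>

lemma comp_eq_iff_stabilizer:
  assumes "x \<in> C" and "y \<in> C"
  shows "\<alpha> \<circ> x \<circ> y = \<alpha> \<circ> x \<longleftrightarrow> y \<in> seq_stabilizer G \<alpha>"
proof -
  have x: "x permutes {1..4 * n}"
    using assms(1) C_subset carrier_dicyclic_permutes by blast
  have "\<alpha> \<circ> x \<circ> y = \<alpha> \<circ> y \<circ> x"
    using C_comm[OF assms] unfolding dicyclic_mult by (simp only: comp_assoc)
  moreover have "\<alpha> \<circ> y \<circ> x = \<alpha> \<circ> x \<longleftrightarrow> \<alpha> \<circ> y = \<alpha>"
    by (metis comp_assoc comp_id permutes_inv_o(1)[OF x])
  ultimately show ?thesis
    using assms(2) C_subset by (auto simp: seq_stabilizer_def)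
qed

text \<open>The normalising factor \<open>\<phi>(1) / card S\<close> is nonzero since \<open>\<phi>(1) = 2\<close>, and tensors are functions of
  multilinear forms, so vanishing is tested form by form. This reduces the tensor identity to
  identities between complex numbers.\<close>

lemma symmetrized_tensor_eq_0_iff:
  assumes "\<phi> = restrict (dicyclic_char n b) (p_regular_elements p G)"
  shows "symmetrized_tensor scale m e G (p_regular_elements p G) \<phi> \<alpha> = 0 \<longleftrightarrow>
    (\<forall>f. (\<Sum>\<tau>\<in>C. dicyclic_char n b \<tau> * basis_tensor scale m e (\<alpha> \<circ> inv\<^bsub>G\<^esub> \<tau>) f) = 0)"
proof -
  let ?S = "p_regular_elements p G"
  let ?T = "\<lambda>\<tau>. basis_tensor scale m e (\<alpha> \<circ> inv\<^bsub>G\<^esub> \<tau>)"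
  have S: "finite ?S" "\<one>\<^bsub>G\<^esub> \<in> ?S"
    using finite_carrier_dicyclic prime_p by (auto simp: p_regular_elements_def)
  have "dicyclic_char n b \<one>\<^bsub>G\<^esub> = 2"
    using dicyclic_char_rotation[OF n_pos, of b 0] by simp
  then have "\<phi> \<one>\<^bsub>G\<^esub> / of_nat (card ?S) \<noteq> 0"
    using S by (auto simp: assms)
  moreover have sum_fun: "(\<Sum>\<tau>\<in>?S. h \<tau>) f = (\<Sum>\<tau>\<in>?S. h \<tau> f)" for h :: "_ \<Rightarrow> 'a tensor" and f
    using S(1) by induction auto
  then have "symmetrized_tensor scale m e G ?S \<phi> \<alpha> f =
      \<phi> \<one>\<^bsub>G\<^esub> / of_nat (card ?S) * (\<Sum>\<tau>\<in>C. dicyclic_char n b \<tau> * ?T \<tau> f)" for f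
    unfolding symmetrized_tensor_def tensor_scale_def sum_fun sum_p_regular_char[symmetric]
    by (simp add: assms)
  ultimately show ?thesis
    by (simp only: fun_eq_iff zero_fun_apply mult_eq_0_iff simp_thms)
qed

text \<open>Here \<open>T\<close> stands for the value of a basis tensor on a fixed form. The character splits into the
  powers of a root of unity and of its conjugate, and both twisted sums vanish.\<close>

lemma sum_char_translates_eq_0:
  fixes b :: nat and T :: "(nat \<Rightarrow> nat) \<Rightarrow> complex"
  assumes s: "c [^]\<^bsub>G\<^esub> s \<in> seq_stabilizer G \<alpha>" and x: "x \<in> C"
    and w: "cis (2 * pi * real b / real l) ^ s \<noteq> 1"
  shows "(\<Sum>\<tau>\<in>C. dicyclic_char n b \<tau> * T (\<alpha> \<circ> x \<circ> inv\<^bsub>G\<^esub> \<tau>)) = 0"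
proof -
  define w where "w = cis (2 * pi * real b / real l)"
  define F where "F m = T (\<alpha> \<circ> x \<circ> inv\<^bsub>G\<^esub> (c [^]\<^bsub>G\<^esub> m))" for m :: nat
  have pow_in_C: "c [^]\<^bsub>G\<^esub> m \<in> C" for m :: nat
    unfolding C_eq by blast
  have wl: "w ^ l = 1"
    using l_pos cis_multiple_2pi[of "real b"] by (simp add: w_def Complex.DeMoivre)
  have Fl: "F (m + l) = F m" for m
    using pow_ord_eq_1[OF c_in_carrier] c_in_carrier unfolding F_def ord_c
    by (simp flip: nat_pow_mult)
  have Fs: "F (m + s) = F m" for m
  proof -
    have inv: "inv\<^bsub>G\<^esub> (c [^]\<^bsub>G\<^esub> j) \<in> C" for j :: nat
      using pow_in_C subgroup.m_inv_closed[OF subgroup_C] by blast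
    have xm: "x \<circ> inv\<^bsub>G\<^esub> (c [^]\<^bsub>G\<^esub> m) \<in> C"
      using subgroup.m_closed[OF subgroup_C x inv] by (simp only: dicyclic_mult)
    have "inv\<^bsub>G\<^esub> (c [^]\<^bsub>G\<^esub> (m + s)) = inv\<^bsub>G\<^esub> (c [^]\<^bsub>G\<^esub> s \<otimes>\<^bsub>G\<^esub> c [^]\<^bsub>G\<^esub> m)"
      using c_in_carrier by (simp add: nat_pow_mult add.commute)
    also have "\<dots> = inv\<^bsub>G\<^esub> (c [^]\<^bsub>G\<^esub> m) \<circ> inv\<^bsub>G\<^esub> (c [^]\<^bsub>G\<^esub> s)"
      using c_in_carrier by (simp only: inv_mult_group nat_pow_closed) (simp only: dicyclic_mult)
    finally have "\<alpha> \<circ> x \<circ> inv\<^bsub>G\<^esub> (c [^]\<^bsub>G\<^esub> (m + s)) =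
        \<alpha> \<circ> (x \<circ> inv\<^bsub>G\<^esub> (c [^]\<^bsub>G\<^esub> m)) \<circ> inv\<^bsub>G\<^esub> (c [^]\<^bsub>G\<^esub> s)"
      by (simp only: comp_assoc)
    also have "\<dots> = \<alpha> \<circ> (x \<circ> inv\<^bsub>G\<^esub> (c [^]\<^bsub>G\<^esub> m))"
      unfolding comp_eq_iff_stabilizer[OF xm inv]
      using s by (rule subgroup.m_inv_closed[OF subgroup_seq_stabilizer])
    finally show ?thesis
      by (simp only: F_def comp_assoc)
  qed
  have "(\<Sum>\<tau>\<in>C. dicyclic_char n b \<tau> * T (\<alpha> \<circ> x \<circ> inv\<^bsub>G\<^esub> \<tau>)) = (\<Sum>m<l. (w ^ m + cnj w ^ m) * F m)"
    using sum_generate_singleton[OF c_in_carrier] l_pos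
    unfolding F_def w_def dicyclic_char_C[symmetric] ord_c by simp
  also have "\<dots> = (\<Sum>m<l. w ^ m * F m) + (\<Sum>m<l. cnj w ^ m * F m)"
    by (simp add: distrib_right sum.distrib)
  also have "(\<Sum>m<l. w ^ m * F m) = 0"
    using w by (intro twisted_periodic_sum_eq_0[of F l s] Fl Fs wl) (simp add: w_def)
  also have "(\<Sum>m<l. cnj w ^ m * F m) = 0"
    using w wl by (intro twisted_periodic_sum_eq_0[of F l s] Fl Fs)
      (simp_all add: w_def flip: complex_cnj_power)
  finally show ?thesis by (simp only: add_0_right)
qed

text \<open>The bracket is the coordinate of the basis tensor at \<open>\<alpha> \<circ> x\<close>; only \<open>\<tau>\<close> in the
  stabilizer contribute, and on the stabilizer the character takes its maximal value \<open>2\<close>.\<close>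

lemma sum_char_stabilizer:
  fixes b :: nat
  assumes H: "C \<inter> seq_stabilizer G \<alpha> = generate G {c [^]\<^bsub>G\<^esub> s}" and x: "x \<in> C"
    and w: "cis (2 * pi * real b / real l) ^ s = 1"
  shows "(\<Sum>\<tau>\<in>C. dicyclic_char n b \<tau> * (if \<alpha> \<circ> x \<circ> inv\<^bsub>G\<^esub> \<tau> = \<alpha> \<circ> x then 1 else 0)) =
    2 * of_nat (card (C \<inter> seq_stabilizer G \<alpha>))"
proof -
  let ?H = "C \<inter> seq_stabilizer G \<alpha>"
  have cs: "c [^]\<^bsub>G\<^esub> s \<in> carrier G"
    using c_in_carrier by (rule nat_pow_closed)
  have char: "dicyclic_char n b \<tau> = 2" if \<tau>: "\<tau> \<in> ?H" for \<tau>
  proof -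
    have "ord (c [^]\<^bsub>G\<^esub> s) \<noteq> 0"
      using ord_ge_1[OF finite_carrier_dicyclic cs] by simp
    then obtain j :: nat where "\<tau> = c [^]\<^bsub>G\<^esub> (s * j)"
      using \<tau> generate_pow_nat[OF cs] unfolding H nat_pow_pow[OF c_in_carrier] by blast
    then show ?thesis
      using dicyclic_char_C[of b "s * j"] w by (simp add: power_mult flip: complex_cnj_power)
  qed
  have mem: "\<alpha> \<circ> x \<circ> inv\<^bsub>G\<^esub> \<tau> = \<alpha> \<circ> x \<longleftrightarrow> \<tau> \<in> ?H" if \<tau>: "\<tau> \<in> C" for \<tau>
  proof -
    have "\<tau> \<in> carrier G"
      using \<tau> C_subset by blast
    then have "inv\<^bsub>G\<^esub> \<tau> \<in> seq_stabilizer G \<alpha> \<longleftrightarrow> \<tau> \<in> seq_stabilizer G \<alpha>"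
      by (metis inv_inv subgroup.m_inv_closed[OF subgroup_seq_stabilizer])
    then show ?thesis
      using comp_eq_iff_stabilizer[OF x subgroup.m_inv_closed[OF subgroup_C \<tau>]] \<tau> by blast
  qed
  have "finite C"
    using C_subset finite_carrier_dicyclic finite_subset by blast
  have "(\<Sum>\<tau>\<in>C. dicyclic_char n b \<tau> * (if \<alpha> \<circ> x \<circ> inv\<^bsub>G\<^esub> \<tau> = \<alpha> \<circ> x then 1 else 0)) =
      (\<Sum>\<tau>\<in>C. if \<tau> \<in> ?H then 2 else 0)"
    by (intro sum.cong refl) (simp only: mem char mult_1_right mult_zero_right split: if_split, blast intro: char)
  also have "\<dots> = (\<Sum>\<tau>\<in>C \<inter> ?H. 2)"
    using \<open>finite C\<close> by (simp only: sum.inter_restrict)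
  also have "\<dots> = 2 * of_nat (card ?H)"
    by (simp add: Int_absorb1)
  finally show ?thesis .
qed

end

section \<open>Vanishing of symmetrized tensors\<close>

theorem proposition4p4:
  fixes scale :: "complex \<Rightarrow> 'v::ab_group_add \<Rightarrow> 'v"
    and ip :: "'v \<Rightarrow> 'v \<Rightarrow> complex"
    and e :: "nat \<Rightarrow> 'v"
    and k p n l t b :: nat
    and \<Delta> :: "(nat \<Rightarrow> nat) set"
    and \<gamma> :: "nat \<Rightarrow> nat"
  defines "G \<equiv> dicyclic n"
    and "r \<equiv> dicyclic_r n"
  defines "S \<equiv> p_regular_elements p G"
    and "C \<equiv> generate G {r [^]\<^bsub>G\<^esub> (p ^ t)}"
    and "G\<^sub>\<gamma> \<equiv> seq_stabilizer G \<gamma>"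
  defines "t\<^sub>\<gamma> \<equiv> l div card (C \<inter> G\<^sub>\<gamma>)"
    and "\<phi> \<equiv> restrict (dicyclic_char n b) S"
  assumes "complex_inner_product_space_onb scale ip k e"
    and "Factorial_Ring.prime p"
    and "2 * n = l * p ^ t"
    and "\<not> p dvd l"
    and "orbit_representatives G (4 * n) k \<Delta>"
    and "\<gamma> \<in> \<Delta>"
    and "1 \<le> b"
    and "real b < real l / 2"
  shows "card (C \<inter> G\<^sub>\<gamma>) dvd l \<and>
         C \<inter> G\<^sub>\<gamma> = generate G {r [^]\<^bsub>G\<^esub> (t\<^sub>\<gamma> * p ^ t)} \<and>
         (\<forall>\<sigma>\<in>C. symmetrized_tensor scale (4 * n) e G S \<phi> (\<gamma> \<circ> \<sigma>) = 0 \<longleftrightarrow>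
                  real b * real t\<^sub>\<gamma> / real l \<notin> \<int>)"
proof -
  interpret V: complex_inner_product_space_onb scale ip k e by fact
  have "l > 0" using assms by auto
  then have "n > 0" using assms by (cases n) (auto simp: prime_gt_0_nat)
  then interpret D: dicyclic_p_part n p l t
    using assms by unfold_locales auto
  define c where "c = r [^]\<^bsub>G\<^esub> (p ^ t)"
  define H where "H = C \<inter> G\<^sub>\<gamma>"
  define w where "w = cis (2 * pi * real b / real l)"
  have \<gamma>: "\<gamma> \<in> index_seqs (4 * n) k"
    using assms(12,13) by (auto simp: orbit_representatives_def)
  have c: "c \<in> carrier G" "D.ord c = l"
    unfolding c_def G_def r_def by (rule D.c_in_carrier D.ord_c)+
  have C: "C = generate G {c}" "subgroup C G" "C \<subseteq> carrier G"
    unfolding c_def C_def G_def r_def by (rule refl D.subgroup_C D.C_subset)+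
  have H: "subgroup H G" "H \<subseteq> generate G {c}"
    using D.subgroups_Inter_pair[OF D.subgroup_C subgroup_seq_stabilizer] C
    by (auto simp: H_def C_def G\<^sub>\<gamma>_def G_def r_def)
  have dvd: "card H dvd l" and H_gen: "H = generate G {c [^]\<^bsub>G\<^esub> t\<^sub>\<gamma>}"
    using D.subgroup_of_finite_cyclic[of c H] c H \<open>l > 0\<close>
    by (auto simp: G_def t\<^sub>\<gamma>_def H_def)
  have "c [^]\<^bsub>G\<^esub> t\<^sub>\<gamma> = r [^]\<^bsub>G\<^esub> (t\<^sub>\<gamma> * p ^ t)"
    unfolding c_def G_def r_def by (simp add: D.nat_pow_pow dicyclic_r_in_carrier mult.commute)
  moreover have "symmetrized_tensor scale (4 * n) e G S \<phi> (\<gamma> \<circ> \<sigma>) = 0 \<longleftrightarrow> w ^ t\<^sub>\<gamma> \<noteq> 1"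
    if \<sigma>: "\<sigma> \<in> C" for \<sigma>
  proof -
    let ?sum = "\<lambda>f. \<Sum>\<tau>\<in>C. dicyclic_char n b \<tau> * basis_tensor scale (4 * n) e (\<gamma> \<circ> \<sigma> \<circ> inv\<^bsub>G\<^esub> \<tau>) f"
    have h: "c [^]\<^bsub>G\<^esub> t\<^sub>\<gamma> \<in> H"
      unfolding H_gen by (auto intro: generate.incl)
    have "symmetrized_tensor scale (4 * n) e G S \<phi> (\<gamma> \<circ> \<sigma>) = 0 \<longleftrightarrow> (\<forall>f. ?sum f = 0)"
      using D.symmetrized_tensor_eq_0_iff[of \<phi> b scale "4 * n" e "\<gamma> \<circ> \<sigma>"]
      by (simp add: \<phi>_def S_def G_def C_def r_def)
    moreover have "?sum f = 0" if "w ^ t\<^sub>\<gamma> \<noteq> 1" for f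
      using D.sum_char_translates_eq_0[of t\<^sub>\<gamma> \<gamma> \<sigma> b "\<lambda>\<beta>. basis_tensor scale (4 * n) e \<beta> f"] \<sigma> h that
      by (simp add: w_def c_def C_def G_def r_def H_def G\<^sub>\<gamma>_def)
    moreover
    (* The coordinate form of the index sequence of the tensor itself is the witness. *)
    let ?f = "\<lambda>v. \<Prod>i\<in>{1..4 * n}. ip (v i) (e ((\<gamma> \<circ> \<sigma>) i))"
    have "?sum ?f \<noteq> 0" if "w ^ t\<^sub>\<gamma> = 1"
    proof -
      have "basis_tensor scale (4 * n) e (\<gamma> \<circ> \<sigma> \<circ> inv\<^bsub>G\<^esub> \<tau>) ?f =
          (if \<gamma> \<circ> \<sigma> \<circ> inv\<^bsub>G\<^esub> \<tau> = \<gamma> \<circ> \<sigma> then 1 else 0)" if \<tau>: "\<tau> \<in> C" for \<tau>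
      proof -
        have perm: "x permutes {1..4 * n}" if "x \<in> C" for x
          using that C(3) carrier_dicyclic_permutes by (auto simp: G_def)
        have "\<gamma> \<circ> \<sigma> \<in> index_seqs (4 * n) k"
          using \<gamma> perm[OF \<sigma>] by (rule index_seqs_permute)
        moreover from this have "\<gamma> \<circ> \<sigma> \<circ> inv\<^bsub>G\<^esub> \<tau> \<in> index_seqs (4 * n) k"
          using perm[OF subgroup.m_inv_closed[OF C(2) \<tau>]] by (rule index_seqs_permute)
        ultimately show ?thesis
          by (intro V.basis_tensor_coordinate)
      qed
      then have "?sum ?f = (\<Sum>\<tau>\<in>C. dicyclic_char n b \<tau> * (if \<gamma> \<circ> \<sigma> \<circ> inv\<^bsub>G\<^esub> \<tau> = \<gamma> \<circ> \<sigma> then 1 else 0))"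
        by (intro sum.cong refl) (simp only:)
      also have "\<dots> = 2 * of_nat (card H)"
        using D.sum_char_stabilizer[of \<gamma> t\<^sub>\<gamma> \<sigma> b] H_gen \<sigma> that
        by (simp only: w_def c_def C_def G_def r_def H_def G\<^sub>\<gamma>_def)
      also have "\<dots> \<noteq> 0"
        using dvd \<open>l > 0\<close> by auto
      finally show ?thesis .
    qed
    ultimately show ?thesis by blast
  qed
  moreover have "w ^ t\<^sub>\<gamma> = 1 \<longleftrightarrow> real b * real t\<^sub>\<gamma> / real l \<in> \<int>"
    unfolding w_def Complex.DeMoivre cis_eq_1_iff by (simp add: field_simps)
  ultimately show ?thesis
    using dvd H_gen by (auto simp: H_def)
qed

end
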